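(* Let $(\Phi,0,S,T)$ be the modular data of an RCFT, and let $M$ be a positive integer such that $\mathbb Q[\xi_M]$ contains all entries of $S$ and $T$. Suppose that $S$ and $T$ obey the $\Gamma(N)$ congruence property for some positive integer $N$, and that for all integers $\ell$ coprime to $M$ one has $$G_\ell T=T^{\ell^2}G_\ell\quad\text{(equivalently } T_{\sigma_\ell a,\sigma_\ell a}=T_{aa}^{\ell^2}\text{ for all }a\in\Phi),$$ $$G_\ell=S\,T^{\frac1\ell}\,S\,T^{\ell}\,S\,T^{\frac1\ell}=T^\ell\,S\,T^{\frac1\ell}\,S\,T^\ell\,S,$$ where $\frac1\ell$ denotes an integer inverse of $\ell$ modulo the order of $T$. Let $\mathfrak C$ denote the complex vector space of all complex matrices (indexed by $\Phi$) commuting with both $S$ and $T$. Then $\mathfrak C$ has a basis over $\mathbb C$ consisting of matrices with integer entries.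
   Context: Write $\xi_n=\exp[2\pi i/n]$. Modular data of an RCFT: a finite set $\Phi$ (primary fields) with a distinguished element $0\in\Phi$, and complex matrices $S,T$ indexed by $\Phi$ such that: $S$ and $T$ are unitary and symmetric; $T$ is diagonal and of finite order; $(ST)^3=I$; $C:=S^2$ (charge conjugation) is a permutation matrix with $C^2=I$, corresponding to a permutation $a\mapsto Ca$ of $\Phi$ with $C0=0$, and $C$ commutes with $S$ and $T$; $S_{0a}\neq 0$ for all $a$; and the fusion coefficients $N_{ab}^c=\sum_{d\in\Phi}S_{ad}S_{bd}\overline{S_{cd}}/S_{0d}$ (Verlinde's formula) are nonnegative integers. These relations define a representation $\rho$ of $\mathrm{SL}_2(\mathbb Z)$ with $\rho\begin{pmatrix}0&1\\-1&0\end{pmatrix}=S$ and $\rho\begin{pmatrix}1&1\\0&1\end{pmatrix}=T$. Congruence property: let $\Gamma(N)=\{A\in \mathrm{SL}_2(\mathbb Z): A\equiv I \pmod N\}$. The $\Gamma(N)$ congruence property means $\rho(A)=I$ for all $A\in\Gamma(N)$. Galois action: it is known that the entries of $S$ lie in a cyclotomic field. For $\ell$ coprime to $M$, $\sigma_\ell$ is the automorphism of $\mathbb Q[\xi_M]$ over $\mathbb Q$ with $\sigma_\ell(\xi_M)=\xi_M^\ell$. It is known that for each such $\sigma=\sigma_\ell$ there are signs $\epsilon_\sigma(a)\in\{\pm1\}$ and a permutation $a\mapsto\sigma a$ of $\Phi$ with $\sigma(S_{ab})=\epsilon_\sigma(a)S_{\sigma a,b}=\epsilon_\sigma(b)S_{a,\sigma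 b}$ for all $a,b\in\Phi$. The matrix $G_\ell=G_{\sigma_\ell}$ is defined by $(G_\sigma)_{ab}=\epsilon_\sigma(a)\delta_{b,\sigma(a)}$, so $\sigma(S)=G_\sigma S=SG_\sigma^{-1}$. *)

theory Defs
  imports
    "HOL-Analysis.Analysis"
    "HOL-Computational_Algebra.Polynomial"
    "HOL-Number_Theory.Cong"
begin

section \<open>Matrix preliminaries\<close>

text \<open>
  On \<open>'a ^ 'n ^ 'n\<close> the type-class operation \<open>*\<close> is entrywise, so \<open>^\<close> is not
  the matrix power.
\<close>

primrec mat_pow :: "'a::semiring_1 ^ 'n ^ 'n \<Rightarrow> nat \<Rightarrow> 'a ^ 'n ^ 'n" where
  "mat_pow A 0 = mat 1"
| "mat_pow A (Suc n) = A ** mat_pow A n"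

definition mat_zpow :: "'a::semiring_1 ^ 'n ^ 'n \<Rightarrow> int \<Rightarrow> 'a ^ 'n ^ 'n" where
  "mat_zpow A k = (if 0 \<le> k then mat_pow A (nat k) else mat_pow (matrix_inv A) (nat (- k)))"

definition finite_order :: "'a::semiring_1 ^ 'n ^ 'n \<Rightarrow> bool" where
  "finite_order A \<longleftrightarrow> (\<exists>n>0. mat_pow A n = mat 1)"

definition mat_order :: "'a::semiring_1 ^ 'n ^ 'n \<Rightarrow> nat" where
  "mat_order A = (LEAST n. 0 < n \<and> mat_pow A n = mat 1)"

definition adjoint_mat :: "complex ^ 'n ^ 'n \<Rightarrow> complex ^ 'n ^ 'n" where
  "adjoint_mat A = (\<chi> i j. cnj (A $ j $ i))"

definition unitary_mat :: "complex ^ 'n ^ 'n \<Rightarrow> bool" where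
  "unitary_mat A \<longleftrightarrow> A ** adjoint_mat A = mat 1 \<and> adjoint_mat A ** A = mat 1"

definition mat_scale :: "complex \<Rightarrow> complex ^ 'n ^ 'n \<Rightarrow> complex ^ 'n ^ 'n" where
  "mat_scale c A = (\<chi> i j. c * A $ i $ j)"

text \<open>
  The library only gives these matrices a real vector space structure; here is the complex
  one, with its \<open>cmat.span\<close> and \<open>cmat.independent\<close>.
\<close>

interpretation cmat: vector_space "mat_scale :: complex \<Rightarrow> complex ^ 'n ^ 'n \<Rightarrow> complex ^ 'n ^ 'n"
  by unfold_locales (simp_all add: mat_scale_def vec_eq_iff algebra_simps)


section \<open>Modular data\<close>

definition fusion_coeff ::
    "'n::finite \<Rightarrow> complex ^ 'n ^ 'n \<Rightarrow> 'n \<Rightarrow> 'n \<Rightarrow> 'n \<Rightarrow> complex" where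
  "fusion_coeff vac S a b c =
     (\<Sum>d\<in>UNIV. S $ a $ d * S $ b $ d * cnj (S $ c $ d) / S $ vac $ d)"

definition modular_data ::
    "'n::finite \<Rightarrow> complex ^ 'n ^ 'n \<Rightarrow> complex ^ 'n ^ 'n \<Rightarrow> bool" where
  "modular_data vac S T \<longleftrightarrow>
     unitary_mat S \<and> transpose S = S \<and>
     unitary_mat T \<and> transpose T = T \<and>
     (\<forall>a b. a \<noteq> b \<longrightarrow> T $ a $ b = 0) \<and> finite_order T \<and>
     mat_pow (S ** T) 3 = mat 1 \<and>
     (\<exists>C :: 'n \<Rightarrow> 'n. bij C \<and> C vac = vac \<and> S ** S = (\<chi> a b. if b = C a then 1 else 0)) \<and>
     (S ** S) ** (S ** S) = mat 1 \<and>
     (S ** S) ** S = S ** (S ** S) \<and> (S ** S) ** T = T ** (S ** S) \<and>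
     (\<forall>a. S $ vac $ a \<noteq> 0) \<and>
     (\<forall>a b c. fusion_coeff vac S a b c \<in> \<nat>)"


section \<open>The representation of the modular group and the congruence property\<close>

definition SL2Z :: "(int ^ 2 ^ 2) set" where
  "SL2Z = {A. det A = 1}"

definition \<Gamma> :: "nat \<Rightarrow> (int ^ 2 ^ 2) set" where
  "\<Gamma> N = {A \<in> SL2Z. \<forall>i j. [A $ i $ j = (mat 1 :: int ^ 2 ^ 2) $ i $ j] (mod int N)}"

definition is_modular_rep ::
    "complex ^ 'n ^ 'n \<Rightarrow> complex ^ 'n ^ 'n \<Rightarrow> (int ^ 2 ^ 2 \<Rightarrow> complex ^ 'n ^ 'n) \<Rightarrow> bool" where
  "is_modular_rep S T \<rho> \<longleftrightarrow>
     \<rho> (mat 1) = mat 1 \<and>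
     (\<forall>A\<in>SL2Z. \<forall>B\<in>SL2Z. \<rho> (A ** B) = \<rho> A ** \<rho> B) \<and>
     \<rho> (vector [vector [0, 1], vector [- 1, 0]]) = S \<and>
     \<rho> (vector [vector [1, 1], vector [0, 1]]) = T"

text \<open>
  \<open>SL\<^sub>2(\<int>)\<close> is presented by these two generators \<open>s\<close>, \<open>t\<close> and the relations
  \<open>s\<^sup>4 = (s t)\<^sup>3 = 1\<close>, \<open>s\<^sup>2\<close> central, so for modular data there is exactly one such \<open>\<rho>\<close> on
  \<open>SL\<^sub>2(\<int>)\<close>; extensionality fixes its values on all other matrices.
\<close>

definition modular_rep ::
    "complex ^ 'n ^ 'n \<Rightarrow> complex ^ 'n ^ 'n \<Rightarrow> (int ^ 2 ^ 2 \<Rightarrow> complex ^ 'n ^ 'n)" where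
  "modular_rep S T = (THE \<rho>. is_modular_rep S T \<rho> \<and> \<rho> \<in> extensional SL2Z)"

definition congruence_property ::
    "nat \<Rightarrow> complex ^ 'n ^ 'n \<Rightarrow> complex ^ 'n ^ 'n \<Rightarrow> bool" where
  "congruence_property N S T \<longleftrightarrow> (\<forall>A\<in>\<Gamma> N. modular_rep S T A = mat 1)"


section \<open>Cyclotomic fields and the Galois action\<close>

definition \<xi> :: "nat \<Rightarrow> complex" where
  "\<xi> n = exp (2 * of_real pi * \<i> / of_nat n)"

text \<open>\<open>\<xi> M\<close> is algebraic, so the field \<open>\<rat>[\<xi> M]\<close> consists of the polynomial expressions in it.\<close>

definition cyclotomic_field :: "nat \<Rightarrow> complex set" where
  "cyclotomic_field M = range (\<lambda>p :: rat poly. poly (map_poly of_rat p) (\<xi> M))"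

definition is_cyclotomic_aut :: "nat \<Rightarrow> int \<Rightarrow> (complex \<Rightarrow> complex) \<Rightarrow> bool" where
  "is_cyclotomic_aut M l \<sigma> \<longleftrightarrow>
     bij_betw \<sigma> (cyclotomic_field M) (cyclotomic_field M) \<and>
     (\<forall>x\<in>cyclotomic_field M. \<forall>y\<in>cyclotomic_field M.
        \<sigma> (x + y) = \<sigma> x + \<sigma> y \<and> \<sigma> (x * y) = \<sigma> x * \<sigma> y) \<and>
     (\<forall>q :: rat. \<sigma> (of_rat q) = of_rat q) \<and>
     \<sigma> (\<xi> M) = \<xi> M powi l"

text \<open>
  For \<open>l\<close> coprime to \<open>M > 0\<close> the automorphism exists and is unique on \<open>\<rat>[\<xi> M]\<close>.
\<close>

definition cyclotomic_aut :: "nat \<Rightarrow> int \<Rightarrow> complex \<Rightarrow> complex" where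
  "cyclotomic_aut M l =
     (THE \<sigma>. is_cyclotomic_aut M l \<sigma> \<and> \<sigma> \<in> extensional (cyclotomic_field M))"

definition is_galois_action ::
    "(complex \<Rightarrow> complex) \<Rightarrow> complex ^ 'n ^ 'n \<Rightarrow> ('n \<Rightarrow> complex) \<Rightarrow> ('n \<Rightarrow> 'n) \<Rightarrow> bool" where
  "is_galois_action \<sigma> S \<epsilon> \<pi> \<longleftrightarrow>
     (\<forall>a. \<epsilon> a \<in> {1, - 1}) \<and> bij \<pi> \<and>
     (\<forall>a b. \<sigma> (S $ a $ b) = \<epsilon> a * S $ \<pi> a $ b \<and>
            \<sigma> (S $ a $ b) = \<epsilon> b * S $ a $ \<pi> b)"

text \<open>
  The signs and the permutation exist for modular data, and the signed permutation matrix \<open>G\<close>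
  they determine satisfies \<open>\<sigma>(S) = G S\<close>; so \<open>G\<close> is unique, as \<open>S\<close> is invertible.
\<close>

definition galois_matrix :: "nat \<Rightarrow> complex ^ 'n ^ 'n \<Rightarrow> int \<Rightarrow> complex ^ 'n ^ 'n" where
  "galois_matrix M S l =
     (THE G. \<exists>\<epsilon> \<pi>. is_galois_action (cyclotomic_aut M l) S \<epsilon> \<pi> \<and>
                   G = (\<chi> a b. if b = \<pi> a then \<epsilon> a else 0))"


section \<open>The commutant\<close>

definition commutant :: "complex ^ 'n ^ 'n \<Rightarrow> complex ^ 'n ^ 'n \<Rightarrow> (complex ^ 'n ^ 'n) set" where
  "commutant S T = {X. X ** S = S ** X \<and> X ** T = T ** X}"

end

theory Submission
  imports Defs "HOL-Computational_Algebra.Fundamental_Theorem_Algebra"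
begin

text \<open>
  The commutant of \<open>S\<close> and \<open>T\<close> is the solution space of a linear system with rational
  coefficients, and the complex solutions of such a system have a basis of integer matrices.

  The condition \<open>X T = T X\<close> only says that \<open>X\<^sub>a\<^sub>b = 0\<close> whenever \<open>T\<^sub>a\<^sub>a \<noteq> T\<^sub>b\<^sub>b\<close>, which is a set of
  rational equations. For \<open>S\<close>, let \<open>f\<close> be a minimal polynomial of \<open>\<xi> M\<close> over the rationals, of
  degree \<open>d\<close>, and write \<open>S = S\<^sub>0 + \<xi> S\<^sub>1 + \<dots> + \<xi>\<^sup>d\<^sup>-\<^sup>1 S\<^sub>d\<^sub>-\<^sub>1\<close> with rational matrices \<open>S\<^sub>k\<close>. For each root \<open>r\<close>
  of \<open>f\<close> there is an automorphism \<open>\<sigma>\<close> of the cyclotomic field with \<open>\<sigma> \<xi> = r\<close>, and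
  \<open>\<sigma>(S) = G\<^sub>\<sigma> S\<close>. By hypothesis \<open>G\<^sub>\<sigma>\<close> is a word in \<open>S\<close> and \<open>T\<close>, so a matrix \<open>X\<close> that commutes
  with \<open>S\<close> and \<open>T\<close> also commutes with \<open>\<sigma>(S)\<close> (\<open>commute_conjugate\<close>). Each entry of
  \<open>\<Sum>\<^sub>k z\<^sup>k (X S\<^sub>k - S\<^sub>k X)\<close> is then a polynomial in \<open>z\<close> of degree below \<open>d\<close> with the \<open>d\<close> distinct
  roots of \<open>f\<close> as zeros (\<open>card_conjugates\<close>), so it is the zero polynomial: \<open>X\<close> commutes with \<open>S\<close>
  and \<open>T\<close> if and only if it commutes with \<open>T\<close> and all the rational matrices \<open>S\<^sub>k\<close>.

  Two facts make the hypothesis on \<open>galois_matrix\<close> usable, since that matrix and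
  \<open>cyclotomic_aut\<close> are definite descriptions. The automorphism exists and is unique
  (\<open>cyclotomic_aut_conjugate\<close>). The signed permutation \<open>G\<^sub>\<sigma>\<close> exists (\<open>galois_action_exists\<close>)
  because \<open>\<sigma>\<close> permutes the characters of the fusion ring, which has integer structure constants.
\<close>

section \<open>Rational linear systems\<close>

text \<open>
  Take for \<open>B\<close> a basis of the rational vector space spanned by the finitely many numbers \<open>x i\<close>.
  Thus \<open>x\<close> becomes a combination of rational vectors, and a rational equation for \<open>x\<close> splits into
  one equation for each of these vectors.
\<close>

lemma rational_decomposition:
  fixes x :: "'i::finite \<Rightarrow> complex"
  obtains B :: "complex set" and R :: "complex \<Rightarrow> 'i \<Rightarrow> rat"
  where "finite B" "\<forall>i. x i = (\<Sum>b\<in>B. of_rat (R b i) * b)"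
    "\<forall>q :: complex \<Rightarrow> rat. (\<Sum>b\<in>B. of_rat (q b) * b) = 0 \<longrightarrow> (\<forall>b\<in>B. q b = 0)"
proof -
  interpret rat_cvec: vector_space "\<lambda>(q::rat) (z::complex). of_rat q * z"
    by unfold_locales (simp_all add: algebra_simps of_rat_add of_rat_mult)
  obtain B where B: "B \<subseteq> range x" "rat_cvec.independent B" "range x \<subseteq> rat_cvec.span B"
    by (rule rat_cvec.maximal_independent_subset)
  have fin: "finite B"
    using finite_subset[OF B(1)] by simp
  show ?thesis
  proof (rule that[OF fin, of "\<lambda>b i. rat_cvec.representation B (x i) b"])
    show "\<forall>i. x i = (\<Sum>b\<in>B. of_rat (rat_cvec.representation B (x i) b) * b)"
    proof
      show "x i = (\<Sum>b\<in>B. of_rat (rat_cvec.representation B (x i) b) * b)" for i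
        by (rule rat_cvec.sum_representation_eq[symmetric]) (use B fin in auto)
    qed
    show "\<forall>q. (\<Sum>b\<in>B. of_rat (q b) * b) = 0 \<longrightarrow> (\<forall>b\<in>B. q b = 0)"
      using rat_cvec.independentD[OF B(2) fin order_refl] by blast
  qed
qed

lemma common_denominator:
  fixes r :: "'i::finite \<Rightarrow> rat"
  obtains D :: int where "D > 0" "\<forall>i. of_int D * r i \<in> \<int>"
proof
  let ?d = "\<lambda>i. snd (quotient_of (r i))"
  show "(\<Prod>i\<in>UNIV. ?d i) > 0"
    by (rule prod_pos) (simp add: quotient_of_denom_pos')
  show "\<forall>i. of_int (\<Prod>i\<in>UNIV. ?d i) * r i \<in> \<int>"
  proof
    fix i
    have "of_int (\<Prod>i\<in>UNIV. ?d i) * r i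
        = of_int (\<Prod>j\<in>UNIV - {i}. ?d j) * (of_int (?d i) * r i)"
      by (subst prod.remove[of _ i]) (simp_all add: mult_ac)
    also have "of_int (?d i) * r i = of_int (fst (quotient_of (r i)))"
      using quotient_of_div[of "r i" "fst (quotient_of (r i))" "?d i"] quotient_of_denom_pos'[of "r i"]
      by (simp add: field_simps)
    finally show "of_int (\<Prod>i\<in>UNIV. ?d i) * r i \<in> \<int>"
      by (metis Ints_of_int of_int_mult)
  qed
qed

text \<open>
  Decompose a solution \<open>X\<close> over a rational basis \<open>B\<close> of the span of its entries,
  \<open>X = \<Sum>\<^sub>b b Y\<^sub>b\<close> with rational matrices \<open>Y\<^sub>b\<close>. By the independence of \<open>B\<close> each \<open>Y\<^sub>b\<close> is a solution,
  and it becomes an integer solution when its denominators are cleared. So the integer solutions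
  span the solution space, and any maximal independent set of them is a basis.
\<close>

lemma integer_basis_of_rational_equations:
  fixes Q :: "('n::finite \<Rightarrow> 'n \<Rightarrow> rat) set"
  defines "V \<equiv> {X :: complex ^ 'n ^ 'n. \<forall>q\<in>Q. (\<Sum>i\<in>UNIV. \<Sum>j\<in>UNIV. of_rat (q i j) * X $ i $ j) = 0}"
  shows "\<exists>B. B \<subseteq> V \<and> cmat.independent B \<and> cmat.span B = V \<and> (\<forall>X\<in>B. \<forall>i j. X $ i $ j \<in> \<int>)"
proof -
  have sub: "cmat.subspace V"
  proof (rule cmat.subspaceI)
    show "0 \<in> V" by (simp add: V_def)
    show "X + Y \<in> V" if "X \<in> V" "Y \<in> V" for X Y
      using that by (simp add: V_def algebra_simps sum.distrib)
    show "mat_scale c X \<in> V" if "X \<in> V" for c X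
    proof -
      have "(\<Sum>i\<in>UNIV. \<Sum>j\<in>UNIV. of_rat (q i j) * mat_scale c X $ i $ j)
          = c * (\<Sum>i\<in>UNIV. \<Sum>j\<in>UNIV. of_rat (q i j) * X $ i $ j)" for q
        by (simp add: mat_scale_def sum_distrib_left mult_ac)
      then show ?thesis using that by (simp add: V_def)
    qed
  qed
  define Z where "Z = {X \<in> V. \<forall>i j. X $ i $ j \<in> \<int>}"
  have V_sub: "V \<subseteq> cmat.span Z"
  proof
    fix X assume X: "X \<in> V"
    obtain B :: "complex set" and R :: "complex \<Rightarrow> 'n \<times> 'n \<Rightarrow> rat" where fin: "finite B"
      and R: "\<forall>p. X $ fst p $ snd p = (\<Sum>b\<in>B. of_rat (R b p) * b)"
      and ind: "\<forall>q :: complex \<Rightarrow> rat. (\<Sum>b\<in>B. of_rat (q b) * b) = 0 \<longrightarrow> (\<forall>b\<in>B. q b = 0)"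
      by (rule rational_decomposition[of "\<lambda>p. X $ fst p $ snd p"])
    have R': "X $ i $ j = (\<Sum>b\<in>B. of_rat (R b (i, j)) * b)" for i j
      using R[rule_format, of "(i, j)"] by simp
    define Y :: "complex \<Rightarrow> complex ^ 'n ^ 'n" where "Y b = (\<chi> i j. of_rat (R b (i, j)))" for b
    have X_eq: "X = (\<Sum>b\<in>B. mat_scale b (Y b))"
      by (simp add: vec_eq_iff mat_scale_def Y_def R' mult.commute)
    have YV: "Y b \<in> V" if b: "b \<in> B" for b
    proof -
      have "(\<Sum>i\<in>UNIV. \<Sum>j\<in>UNIV. of_rat (q i j) * Y b $ i $ j) = 0" if q: "q \<in> Q" for q
      proof -
        have "0 = (\<Sum>i\<in>UNIV. \<Sum>j\<in>UNIV. of_rat (q i j) * X $ i $ j)"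
          using X q by (simp add: V_def)
        also have "\<dots> = (\<Sum>i\<in>UNIV. \<Sum>j\<in>UNIV. \<Sum>b\<in>B. of_rat (q i j) * (of_rat (R b (i, j)) * b))"
          by (simp add: R' sum_distrib_left)
        also have "\<dots> = (\<Sum>i\<in>UNIV. \<Sum>b\<in>B. \<Sum>j\<in>UNIV. of_rat (q i j) * (of_rat (R b (i, j)) * b))"
          by (intro sum.cong refl sum.swap)
        also have "\<dots> = (\<Sum>b\<in>B. \<Sum>i\<in>UNIV. \<Sum>j\<in>UNIV. of_rat (q i j) * (of_rat (R b (i, j)) * b))"
          by (rule sum.swap)
        also have "\<dots> = (\<Sum>b\<in>B. of_rat (\<Sum>i\<in>UNIV. \<Sum>j\<in>UNIV. q i j * R b (i, j)) * b)"
          by (simp add: of_rat_sum of_rat_mult sum_distrib_right mult.assoc)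
        finally have "(\<Sum>i\<in>UNIV. \<Sum>j\<in>UNIV. q i j * R b (i, j)) = 0"
          using ind[rule_format, of "\<lambda>b. \<Sum>i\<in>UNIV. \<Sum>j\<in>UNIV. q i j * R b (i, j)"] b by simp
        then have "of_rat (\<Sum>i\<in>UNIV. \<Sum>j\<in>UNIV. q i j * R b (i, j)) = (0 :: complex)"
          by simp
        then show ?thesis
          by (simp add: Y_def of_rat_sum of_rat_mult)
      qed
      then show ?thesis by (simp add: V_def)
    qed
    have "Y b \<in> cmat.span Z" if b: "b \<in> B" for b
    proof -
      obtain D :: int where D: "D > 0" "\<forall>p. of_int D * R b p \<in> \<int>"
        by (rule common_denominator[of "R b"])
      have "of_int D * Y b $ i $ j \<in> \<int>" for i j
      proof -
        obtain z where "of_int D * R b (i, j) = of_int z"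
          using D(2)[rule_format, of "(i, j)"] by (rule Ints_cases)
        then have "of_rat (of_int D * R b (i, j)) = (of_int z :: complex)"
          by (metis of_rat_of_int_eq)
        then show ?thesis by (simp add: Y_def of_rat_mult)
      qed
      then have "mat_scale (of_int D) (Y b) \<in> Z"
        using cmat.subspace_scale[OF sub YV[OF b]] by (simp add: Z_def mat_scale_def)
      then have "mat_scale (1 / of_int D) (mat_scale (of_int D) (Y b)) \<in> cmat.span Z"
        by (intro cmat.span_scale cmat.span_base)
      then show ?thesis using D(1) by simp
    qed
    then show "X \<in> cmat.span Z"
      unfolding X_eq by (intro cmat.span_sum cmat.span_scale)
  qed
  obtain B where B: "B \<subseteq> Z" "cmat.independent B" "Z \<subseteq> cmat.span B"
    by (rule cmat.maximal_independent_subset)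
  have "cmat.span B \<subseteq> V"
    using B(1) by (intro cmat.span_minimal sub) (auto simp: Z_def)
  moreover have "V \<subseteq> cmat.span B"
    using V_sub cmat.span_minimal[OF B(3) cmat.subspace_span] by blast
  ultimately show ?thesis
    using B by (intro exI[of _ B]) (auto simp: Z_def)
qed

section \<open>Minimal polynomials and conjugates\<close>

definition rat_eval :: "rat poly \<Rightarrow> complex \<Rightarrow> complex" where
  "rat_eval p z = poly (map_poly of_rat p) z"

lemma rat_eval_0 [simp]: "rat_eval 0 z = 0"
  by (simp add: rat_eval_def)

lemma rat_eval_pCons [simp]: "rat_eval (pCons a p) z = of_rat a + z * rat_eval p z"
  by (simp add: rat_eval_def map_poly_pCons)

lemma rat_eval_1 [simp]: "rat_eval 1 z = 1"
  by (simp add: one_pCons)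

lemma rat_eval_add [simp]: "rat_eval (p + q) z = rat_eval p z + rat_eval q z"
proof (induction p arbitrary: q)
  case (pCons a p)
  then show ?case by (cases q) (simp add: of_rat_add algebra_simps)
qed simp

lemma rat_eval_smult [simp]: "rat_eval (smult a p) z = of_rat a * rat_eval p z"
  by (induction p) (simp_all add: of_rat_mult algebra_simps)

lemma rat_eval_mult [simp]: "rat_eval (p * q) z = rat_eval p z * rat_eval q z"
  by (induction p) (simp_all add: algebra_simps)

lemma rat_eval_diff [simp]: "rat_eval (p - q) z = rat_eval p z - rat_eval q z"
  using rat_eval_add[of "p - q" q z] by simp

lemma rat_eval_power [simp]: "rat_eval (p ^ n) z = rat_eval p z ^ n"
  by (induction n) simp_all

lemma rat_eval_pcompose: "rat_eval (pcompose p q) z = rat_eval p (rat_eval q z)"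
  by (induction p) (simp_all add: pcompose_pCons)

text \<open>
  The minimal polynomial is determined only up to a nonzero factor here: what is used of it is that
  it generates the ideal of rational polynomials that vanish at \<open>z\<close>.
\<close>

definition is_minimal_poly :: "complex \<Rightarrow> rat poly \<Rightarrow> bool" where
  "is_minimal_poly z f \<longleftrightarrow> f \<noteq> 0 \<and> (\<forall>p. rat_eval p z = 0 \<longleftrightarrow> f dvd p)"

lemma is_minimal_poly_exists:
  assumes "g \<noteq> 0" "rat_eval g z = 0"
  obtains f where "is_minimal_poly z f"
proof -
  define d where "d = (LEAST d. \<exists>p. p \<noteq> 0 \<and> rat_eval p z = 0 \<and> degree p = d)"
  have "\<exists>p. p \<noteq> 0 \<and> rat_eval p z = 0 \<and> degree p = d"
    unfolding d_def by (rule LeastI_ex) (use assms in blast)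
  then obtain f where f: "f \<noteq> 0" "rat_eval f z = 0" "degree f = d" by blast
  have "f dvd p" if p: "rat_eval p z = 0" for p
  proof (rule ccontr)
    assume "\<not> f dvd p"
    then have ne: "p mod f \<noteq> 0" by (simp add: mod_eq_0_iff_dvd)
    have "rat_eval (p mod f) z = 0"
      using p f(2) by (simp flip: minus_div_mult_eq_mod)
    then have "d \<le> degree (p mod f)"
      unfolding d_def by (intro Least_le) (use ne in blast)
    then show False
      using degree_mod_less[OF f(1), of p] ne f(3) by simp
  qed
  then have "is_minimal_poly z f"
    using f by (auto simp: is_minimal_poly_def elim!: dvdE)
  then show ?thesis by (rule that)
qed

text \<open>
  A minimal polynomial \<open>g\<close> of \<open>r\<close> divides \<open>f\<close>, say \<open>f = g h\<close>. At \<open>z\<close> one of the factors vanishes,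
  and it is a multiple of \<open>f\<close>. It cannot be \<open>h\<close>, whose degree is smaller than that of \<open>f\<close>, so \<open>f\<close>
  and \<open>g\<close> divide each other.
\<close>

lemma is_minimal_poly_conjugate:
  assumes f: "is_minimal_poly z f" and r: "rat_eval f r = 0"
  shows "is_minimal_poly r f"
proof -
  have f0: "f \<noteq> 0" and fz: "\<And>p. rat_eval p z = 0 \<longleftrightarrow> f dvd p"
    using f by (auto simp: is_minimal_poly_def)
  obtain g where g: "is_minimal_poly r g"
    using is_minimal_poly_exists f0 r by blast
  then have g0: "g \<noteq> 0" and gr: "\<And>p. rat_eval p r = 0 \<longleftrightarrow> g dvd p"
    by (auto simp: is_minimal_poly_def)
  obtain h where h: "f = g * h" using r gr by (auto elim: dvdE)
  have "rat_eval g z * rat_eval h z = 0"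
    using fz[of f] by (simp add: h)
  then have "f dvd g \<or> f dvd h"
    using fz by simp
  moreover have "\<not> f dvd h"
  proof
    assume dvd: "f dvd h"
    have "h \<noteq> 0" using f0 h by auto
    then have "degree g = 0"
      using dvd_imp_degree_le[OF dvd] g0 by (simp add: h degree_mult_eq)
    then obtain c where "g = [:c:]" by (rule degree_eq_zeroE)
    then show False
      using gr[of g] g0 by simp
  qed
  ultimately have "f dvd g" by blast
  then have "rat_eval p r = 0 \<longleftrightarrow> f dvd p" for p
    unfolding gr using h by (metis dvd_trans dvd_triv_left)
  then show ?thesis using f0 by (simp add: is_minimal_poly_def)
qed

lemma xi_power_eq_1_iff:
  assumes "M > 0"
  shows "\<xi> M ^ k = 1 \<longleftrightarrow> M dvd k"
proof -
  have "\<xi> M ^ k = exp (2 * of_real pi * \<i> * of_nat k / of_nat M)"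
    by (simp add: \<xi>_def mult_ac flip: exp_of_nat_mult)
  then show ?thesis using complex_root_unity_eq_1[of M k] assms by simp
qed

lemma xi_power_cong:
  assumes "M > 0" "[k = l] (mod M)"
  shows "\<xi> M ^ k = \<xi> M ^ l"
proof -
  have "\<xi> M ^ k = \<xi> M ^ (k mod M)" for k
    using xi_power_eq_1_iff[OF assms(1), of M]
    by (metis div_mult_mod_eq dvd_refl mult.commute mult_1 power_add power_mult power_one)
  then show ?thesis using assms(2) by (metis cong_def)
qed

lemma root_of_unity_eq_xi_power:
  assumes "M > 0" "r ^ M = 1"
  obtains l where "r = \<xi> M ^ l"
proof -
  have "r \<in> {exp (2 * of_real pi * \<i> * of_nat j / of_nat M) | j. j < M}"
    using complex_roots_unity[of M] assms by auto
  then show ?thesis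
    using that by (auto simp: \<xi>_def mult_ac simp flip: exp_of_nat_mult)
qed

text \<open>
  An exponent \<open>l\<close> of \<open>\<xi> M\<close> matters only modulo \<open>M\<close>; this allows a representative that is also
  invertible modulo the order of \<open>T\<close>. Take for \<open>k\<close> the product of the primes that divide \<open>D\<close> but
  not \<open>l\<close>: each prime factor of \<open>D\<close> then divides exactly one of \<open>l\<close> and \<open>M k\<close>.
\<close>

lemma coprime_shift:
  fixes l M D :: nat
  assumes "coprime l M" "D > 0"
  obtains k where "coprime (l + M * k) D"
proof
  define P where "P = {p \<in> prime_factors D. \<not> p dvd l}"
  have fin: "finite P" by (simp add: P_def)
  show "coprime (l + M * \<Prod>P) D"
  proof (rule ccontr)
    assume "\<not> coprime (l + M * \<Prod>P) D"
    then have "gcd (l + M * \<Prod>P) D \<noteq> 1"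
      by (simp add: coprime_iff_gcd_eq_1)
    then obtain p where "prime p" "p dvd gcd (l + M * \<Prod>P) D"
      using prime_factor_nat by blast
    then have p: "prime p" "p dvd l + M * \<Prod>P" "p dvd D"
      by auto
    show False
    proof (cases "p dvd l")
      case True
      then have "p dvd M * \<Prod>P" using p(2) by (simp add: dvd_add_right_iff)
      moreover have "\<not> p dvd M"
        using True assms(1) p(1) by (meson coprime_common_divisor not_prime_unit)
      ultimately have "p dvd \<Prod>P" using p(1) prime_dvd_multD by blast
      then obtain q where q: "q \<in> P" "p dvd q"
        using p(1) fin prime_dvd_prod_iff[of P p "\<lambda>x. x"] by auto
      then have "p = q" using p(1) primes_dvd_imp_eq by (auto simp: P_def)
      then show False using q True by (simp add: P_def)
    next
      case False
      then have "p \<in> P" using p assms(2) by (auto simp: P_def in_prime_factors_iff)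
      then have "p dvd M * \<Prod>P" using dvd_prodI[OF fin, of p "\<lambda>x. x"] by simp
      then show False using False p(2) by (simp add: dvd_add_left_iff)
    qed
  qed
qed

text \<open>
  The minimal polynomial divides \<open>x\<^sup>M - 1\<close>, whose derivative \<open>M x\<^sup>M\<^sup>-\<^sup>1\<close> does not vanish at any root
  of unity. So \<open>f\<close> has no multiple complex roots.
\<close>

lemma card_conjugates:
  assumes M: "M > 0" and f: "is_minimal_poly (\<xi> M) f"
  shows "card {r. rat_eval f r = 0} = degree f" and "\<And>r. rat_eval f r = 0 \<Longrightarrow> r ^ M = 1"
proof -
  have "rat_eval ([:0, 1:] ^ M - 1) (\<xi> M) = 0"
    using xi_power_eq_1_iff[OF M, of M] by simp
  then obtain h where h: "[:0, 1:] ^ M - 1 = f * h"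
    using f unfolding is_minimal_poly_def by (metis dvdE)
  have fh: "r ^ M - 1 = rat_eval f r * rat_eval h r" for r
    using arg_cong[OF h, of "\<lambda>p. rat_eval p r"] by simp
  then show root: "\<And>r. rat_eval f r = 0 \<Longrightarrow> r ^ M = 1"
    by (metis eq_iff_diff_eq_0 mult_zero_left)
  let ?F = "map_poly of_rat f :: complex poly" and ?H = "map_poly of_rat h :: complex poly"
  have F0: "?F \<noteq> 0"
    using f by (simp add: is_minimal_poly_def map_poly_eq_0_iff)
  have "monom 1 M - 1 = ?F * ?H"
    using fh by (intro iffD1[OF poly_eq_poly_eq_iff] ext) (simp add: poly_monom rat_eval_def)
  note eq = this
  have deriv: "of_nat M * r ^ (M - 1)
      = poly ?F r * poly (pderiv ?H) r + poly ?H r * poly (pderiv ?F) r" for r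
  proof -
    have "of_nat M * r ^ (M - 1) = poly (pderiv (monom 1 M - 1)) r"
      by (simp add: pderiv_diff pderiv_monom poly_monom)
    then show ?thesis
      by (simp add: eq pderiv_mult)
  qed
  have "rsquarefree ?F"
    unfolding rsquarefree_roots
  proof (intro allI notI)
    fix r assume "poly ?F r = 0 \<and> poly (pderiv ?F) r = 0"
    then have "of_nat M * r ^ (M - 1) = 0" "r ^ M = 1"
      using deriv[of r] root[of r] by (auto simp: rat_eval_def)
    then show False using M by (auto simp: power_0_left)
  qed
  then have "smult (lead_coeff ?F) (\<Prod>r | poly ?F r = 0. [:-r, 1:]) = ?F"
    by (rule complex_poly_decompose_rsquarefree)
  then have "degree ?F = degree (\<Prod>r | poly ?F r = 0. [:-r, 1:])"
    using F0 by (metis degree_smult_eq leading_coeff_0_iff)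
  also have "\<dots> = card {r. poly ?F r = 0}"
    by (subst degree_prod_sum_eq) simp_all
  finally show "card {r. rat_eval f r = 0} = degree f"
    by (simp add: rat_eval_def degree_map_poly)
qed

section \<open>Automorphisms of the cyclotomic field\<close>

lemma cyclotomic_field_iff: "x \<in> cyclotomic_field M \<longleftrightarrow> (\<exists>p. x = rat_eval p (\<xi> M))"
  by (auto simp: cyclotomic_field_def rat_eval_def)

lemma rat_eval_in_field [simp]: "rat_eval p (\<xi> M) \<in> cyclotomic_field M"
  by (auto simp: cyclotomic_field_iff)

lemma cyclotomic_field_closed:
  shows "of_rat q \<in> cyclotomic_field M"
    and "\<xi> M \<in> cyclotomic_field M"
    and "x \<in> cyclotomic_field M \<Longrightarrow> y \<in> cyclotomic_field M \<Longrightarrow> x + y \<in> cyclotomic_field M"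
    and "x \<in> cyclotomic_field M \<Longrightarrow> y \<in> cyclotomic_field M \<Longrightarrow> x * y \<in> cyclotomic_field M"
proof -
  show "of_rat q \<in> cyclotomic_field M"
    using rat_eval_in_field[of "[:q:]" M] by simp
  show "\<xi> M \<in> cyclotomic_field M"
    using rat_eval_in_field[of "[:0, 1:]" M] by simp
  show "x + y \<in> cyclotomic_field M" "x * y \<in> cyclotomic_field M"
    if "x \<in> cyclotomic_field M" "y \<in> cyclotomic_field M"
    using that by (metis cyclotomic_field_iff rat_eval_add, metis cyclotomic_field_iff rat_eval_mult)
qed

lemma is_cyclotomic_autD:
  assumes "is_cyclotomic_aut M l \<sigma>"
  shows "\<And>q. \<sigma> (of_rat q) = of_rat q"
    and "\<And>x y. x \<in> cyclotomic_field M \<Longrightarrow> y \<in> cyclotomic_field M \<Longrightarrow> \<sigma> (x + y) = \<sigma> x + \<sigma> y"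
    and "\<And>x y. x \<in> cyclotomic_field M \<Longrightarrow> y \<in> cyclotomic_field M \<Longrightarrow> \<sigma> (x * y) = \<sigma> x * \<sigma> y"
    and "\<And>x y. x \<in> cyclotomic_field M \<Longrightarrow> y \<in> cyclotomic_field M \<Longrightarrow> \<sigma> x = \<sigma> y \<Longrightarrow> x = y"
    and "\<sigma> (\<xi> M) = \<xi> M powi l"
  using assms unfolding is_cyclotomic_aut_def bij_betw_def by (auto dest: inj_onD)

lemma is_cyclotomic_aut_rat_eval:
  assumes aut: "is_cyclotomic_aut M l \<sigma>"
  shows "\<sigma> (rat_eval p (\<xi> M)) = rat_eval p (\<xi> M powi l)"
proof (induction p)
  case 0
  show ?case using is_cyclotomic_autD(1)[OF aut, of 0] by simp
next
  case (pCons a p)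
  then show ?case
    by (simp add: is_cyclotomic_autD[OF aut] cyclotomic_field_closed)
qed

text \<open>
  As \<open>\<xi> M\<close> and \<open>\<xi> M ^ l\<close> have the same minimal polynomial, two rational polynomials agree at one
  of them if and only if they agree at the other. Hence \<open>p(\<xi> M) \<mapsto> p(\<xi> M ^ l)\<close> is a well-defined
  injective map. It is onto because \<open>\<xi> M\<close> is a power of \<open>\<xi> M ^ l\<close>, and it is the only candidate
  because an automorphism is determined by its value at \<open>\<xi> M\<close>.
\<close>

lemma cyclotomic_aut_conjugate:
  assumes M: "M > 0" and f: "is_minimal_poly (\<xi> M) f"
    and root: "rat_eval f (\<xi> M ^ l) = 0" and cop: "coprime l M"
  shows "is_cyclotomic_aut M (int l) (cyclotomic_aut M (int l))"
proof -
  let ?K = "cyclotomic_field M"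
  have f': "is_minimal_poly (\<xi> M ^ l) f"
    by (rule is_minimal_poly_conjugate[OF f root])
  have eq_iff: "rat_eval p (\<xi> M) = rat_eval q (\<xi> M) \<longleftrightarrow>
      rat_eval p (\<xi> M ^ l) = rat_eval q (\<xi> M ^ l)" for p q
    using f f' unfolding is_minimal_poly_def
    by (metis eq_iff_diff_eq_0 rat_eval_diff)
  define s where "s = restrict (\<lambda>x. rat_eval (SOME p. rat_eval p (\<xi> M) = x) (\<xi> M ^ l)) ?K"
  have s: "s (rat_eval p (\<xi> M)) = rat_eval p (\<xi> M ^ l)" for p
    unfolding s_def using someI[of "\<lambda>q. rat_eval q (\<xi> M) = rat_eval p (\<xi> M)" p] eq_iff by simp
  obtain m where m: "[l * m = Suc 0] (mod M)"
    using cong_solve_coprime_nat[OF cop] by auto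
  have aut: "is_cyclotomic_aut M (int l) s"
    unfolding is_cyclotomic_aut_def bij_betw_def
  proof (intro conjI ballI allI)
    show "inj_on s ?K"
      using s eq_iff by (auto simp: inj_on_def cyclotomic_field_iff)
    have "s (rat_eval (pcompose p ([:0, 1:] ^ m)) (\<xi> M)) = rat_eval p (\<xi> M)" for p
    proof -
      have "(\<xi> M ^ l) ^ m = \<xi> M"
        using xi_power_cong[OF M m] by (simp add: power_mult)
      then show ?thesis by (simp only: s) (simp add: rat_eval_pcompose)
    qed
    then have "?K \<subseteq> s ` ?K"
      by (metis cyclotomic_field_iff image_eqI rat_eval_in_field subsetI)
    moreover have "s x \<in> ?K" if "x \<in> ?K" for x
    proof -
      obtain p where "x = rat_eval p (\<xi> M)" using \<open>x \<in> ?K\<close> by (auto simp: cyclotomic_field_iff)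
      then have "s x = rat_eval (pcompose p ([:0, 1:] ^ l)) (\<xi> M)"
        by (simp add: s rat_eval_pcompose)
      then show ?thesis by simp
    qed
    ultimately show "s ` ?K = ?K" by blast
    show "s (x + y) = s x + s y" "s (x * y) = s x * s y" if xy: "x \<in> ?K" "y \<in> ?K" for x y
    proof -
      obtain p q where "x = rat_eval p (\<xi> M)" "y = rat_eval q (\<xi> M)"
        using xy by (auto simp: cyclotomic_field_iff)
      then show "s (x + y) = s x + s y" "s (x * y) = s x * s y"
        using s[of "p + q"] s[of "p * q"] by (simp_all add: s)
    qed
    show "s (of_rat q) = of_rat q" for q
      using s[of "[:q:]"] by simp
    show "s (\<xi> M) = \<xi> M powi int l"
      using s[of "[:0, 1:]"] by simp
  qed
  have "\<exists>!\<sigma>. is_cyclotomic_aut M (int l) \<sigma> \<and> \<sigma> \<in> extensional ?K"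
  proof (rule ex1I[of _ s])
    show "is_cyclotomic_aut M (int l) s \<and> s \<in> extensional ?K"
      using aut by (simp add: s_def)
    show "\<sigma> = s" if "is_cyclotomic_aut M (int l) \<sigma> \<and> \<sigma> \<in> extensional ?K" for \<sigma>
    proof (rule extensionalityI[of _ ?K])
      fix x assume "x \<in> ?K"
      then obtain p where "x = rat_eval p (\<xi> M)" by (auto simp: cyclotomic_field_iff)
      then show "\<sigma> x = s x"
        using is_cyclotomic_aut_rat_eval[of M "int l" \<sigma>] that s by simp
    next
    qed (use that in \<open>auto simp: s_def\<close>)
  qed
  then show ?thesis
    unfolding cyclotomic_aut_def by (rule conjunct1[OF theI'])
qed

text \<open>
  A conjugate \<open>r\<close> of \<open>\<xi> M\<close> satisfies the same rational equations \<open>x\<^sup>k = 1\<close>, so it is again a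
  primitive \<open>M\<close>-th root of unity. The modulus \<open>D\<close> will be the order of \<open>T\<close>.
\<close>

lemma conjugate_is_coprime_power:
  assumes M: "M > 0" and f: "is_minimal_poly (\<xi> M) f"
    and r: "rat_eval f r = 0" and D: "D > 0"
  obtains l where "coprime l M" "coprime l D" "r = \<xi> M ^ l"
proof -
  obtain l where l: "r = \<xi> M ^ l"
    using root_of_unity_eq_xi_power[OF M card_conjugates(2)[OF M f r]] .
  have f': "is_minimal_poly r f"
    by (rule is_minimal_poly_conjugate[OF f r])
  have pow: "M dvd k" if "r ^ k = 1" for k
  proof -
    have "rat_eval ([:0, 1:] ^ k - 1) r = 0" using that by simp
    then have "rat_eval ([:0, 1:] ^ k - 1) (\<xi> M) = 0"
      using f f' by (simp only: is_minimal_poly_def)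
    then show ?thesis using xi_power_eq_1_iff[OF M, of k] by simp
  qed
  define g where "g = gcd l M"
  have g: "g > 0" "g dvd l" "g dvd M" using M by (simp_all add: g_def)
  have "l * (M div g) = M * (l div g)"
    using g by (auto elim!: dvdE simp: mult_ac)
  then have "r ^ (M div g) = \<xi> M ^ (M * (l div g))"
    by (simp add: l flip: power_mult)
  also have "\<dots> = 1" using xi_power_eq_1_iff[OF M] by simp
  finally have "M dvd M div g" by (rule pow)
  moreover have "M div g > 0"
    using M g by (simp add: div_greater_zero_iff dvd_imp_le)
  ultimately have "M \<le> M div g"
    by (rule dvd_imp_le)
  then have "g = 1"
    using M g(1) div_less_dividend[of g M] by linarith
  then have "coprime l M" by (simp add: g_def coprime_iff_gcd_eq_1)
  then obtain k where k: "coprime (l + M * k) D" using coprime_shift D by blast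
  show ?thesis
  proof (rule that[OF _ k])
    show "coprime (l + M * k) M"
      using \<open>coprime l M\<close> gcd_add_mult[of M k l]
      by (simp add: coprime_iff_gcd_eq_1 gcd.commute add.commute mult.commute)
    show "r = \<xi> M ^ (l + M * k)"
      unfolding l by (rule xi_power_cong[OF M]) (simp add: cong_def)
  qed
qed

section \<open>The Galois action on modular data\<close>

text \<open>
  Write \<open>0\<close> for \<open>vac\<close>. By Verlinde's formula the functions \<open>a \<mapsto> S\<^sub>a\<^sub>d / S\<^sub>0\<^sub>d\<close>, one for each primary field \<open>d\<close>, are
  characters of the fusion ring, and there are no others. The structure constants of this ring are
  integers, hence fixed by \<open>\<sigma>\<close>, so \<open>\<sigma>\<close> sends characters to characters: this gives the permutation
  \<open>\<pi>\<close>, up to the factors \<open>\<sigma>(S\<^sub>0\<^sub>d) / S\<^sub>0\<^sub>\<pi>\<^sub>d\<close>. As \<open>S\<close> is unitary and charge conjugation expresses the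
  complex conjugate of \<open>S\<close> through \<open>S\<close>, the square \<open>1 / S\<^sub>0\<^sub>d\<^sup>2\<close> is a rational expression in the values
  of the \<open>d\<close>-th character. So these factors square to \<open>1\<close>: they are the signs.
\<close>

lemma galois_action_exists:
  fixes S T :: "complex ^ 'n::finite ^ 'n"
  assumes modular: "modular_data vac S T"
    and entries: "\<And>a b. S $ a $ b \<in> cyclotomic_field M"
    and aut: "is_cyclotomic_aut M l \<sigma>"
  shows "\<exists>\<epsilon> \<pi>. is_galois_action \<sigma> S \<epsilon> \<pi>"
proof -
  note [simp] = entries cyclotomic_field_closed(3,4)
  note aut_simps = is_cyclotomic_autD[OF aut]
  have K_of_nat [simp]: "of_nat n \<in> cyclotomic_field M" for n
    using cyclotomic_field_closed(1)[of "of_nat n" M] by simp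
  have \<sigma>_of_nat: "\<sigma> (of_nat n) = of_nat n" for n
    using aut_simps(1)[of "of_nat n"] by simp
  have K_sum [simp]: "(\<Sum>a\<in>A. g a) \<in> cyclotomic_field M"
    if "\<And>a. g a \<in> cyclotomic_field M" for A and g :: "'n \<Rightarrow> complex"
    using K_of_nat[of 0] that by (induction A rule: infinite_finite_induct) auto
  have \<sigma>_sum: "\<sigma> (\<Sum>a\<in>A. g a) = (\<Sum>a\<in>A. \<sigma> (g a))"
    if "\<And>a. g a \<in> cyclotomic_field M" for A and g :: "'n \<Rightarrow> complex"
    using \<sigma>_of_nat[of 0] that
    by (induction A rule: infinite_finite_induct) (auto simp: aut_simps(2))

  have unit: "S ** adjoint_mat S = mat 1" "adjoint_mat S ** S = mat 1"
    and "transpose S = S"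
    and vac_nz: "\<And>a. S $ vac $ a \<noteq> 0"
    and fusion_nat: "\<And>a b c. fusion_coeff vac S a b c \<in> \<nat>"
    and SSSS: "(S ** S) ** (S ** S) = mat 1"
    using modular by (auto simp: modular_data_def unitary_mat_def)
  have sym: "S $ a $ b = S $ b $ a" for a b
    using \<open>transpose S = S\<close> by (metis transpose_def vec_lambda_beta)
  obtain C where C: "C vac = vac" "S ** S = (\<chi> a b. if b = C a then 1 else 0)"
    using modular by (auto simp: modular_data_def)
  \<comment> \<open>Unitarity gives \<open>adjoint_mat S = S\<^sup>3 = C S\<close>.\<close>
  have cnj_S: "cnj (S $ a $ b) = S $ C a $ b" for a b
  proof -
    have "adjoint_mat S = adjoint_mat S ** ((S ** S) ** (S ** S))"
      by (simp add: SSSS)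
    also have "\<dots> = (adjoint_mat S ** S) ** ((S ** S) ** S)"
      by (simp add: matrix_mul_assoc)
    finally have "adjoint_mat S = (S ** S) ** S"
      by (simp add: unit)
    then have "adjoint_mat S $ a $ b = ((\<chi> a b. if b = C a then 1 else 0) ** S) $ a $ b"
      by (simp only: C(2))
    then show ?thesis
      using sym[of a b]
      by (simp add: adjoint_mat_def matrix_matrix_mult_def if_distrib[of "\<lambda>x. x * _"] cong: if_cong)
  qed

  have cols: "(\<Sum>a\<in>UNIV. cnj (S $ a $ d) * S $ a $ e) = (if d = e then 1 else 0)" for d e
    using arg_cong[OF unit(2), of "\<lambda>X. X $ d $ e"]
    by (simp add: matrix_matrix_mult_def adjoint_mat_def mat_def)
  have rows: "(\<Sum>e\<in>UNIV. S $ c $ e * cnj (S $ a $ e)) = (if c = a then 1 else 0)" for c a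
    using arg_cong[OF unit(1), of "\<lambda>X. X $ c $ a"]
    by (simp add: matrix_matrix_mult_def adjoint_mat_def mat_def)
  have expand: "(\<Sum>b\<in>UNIV. cnj (S $ b $ f) * (\<Sum>e\<in>UNIV. g e * S $ b $ e)) = g f" for f g
  proof -
    have "(\<Sum>b\<in>UNIV. cnj (S $ b $ f) * (\<Sum>e\<in>UNIV. g e * S $ b $ e))
        = (\<Sum>b\<in>UNIV. \<Sum>e\<in>UNIV. g e * (cnj (S $ b $ f) * S $ b $ e))"
      by (simp add: sum_distrib_left mult_ac)
    also have "\<dots> = (\<Sum>e\<in>UNIV. \<Sum>b\<in>UNIV. g e * (cnj (S $ b $ f) * S $ b $ e))"
      by (rule sum.swap)
    also have "\<dots> = (\<Sum>e\<in>UNIV. g e * (\<Sum>b\<in>UNIV. cnj (S $ b $ f) * S $ b $ e))"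
      by (simp add: sum_distrib_left)
    also have "\<dots> = g f"
      by (simp add: cols if_distrib[of "\<lambda>x. _ * x"] cong: if_cong)
    finally show ?thesis .
  qed
  have fusion_sum: "(\<Sum>c\<in>UNIV. fusion_coeff vac S a b c * h c)
      = (\<Sum>e\<in>UNIV. (S $ a $ e * S $ b $ e / S $ vac $ e) * (\<Sum>c\<in>UNIV. cnj (S $ c $ e) * h c))"
    for a b h
  proof -
    have "(\<Sum>c\<in>UNIV. fusion_coeff vac S a b c * h c)
        = (\<Sum>c\<in>UNIV. \<Sum>e\<in>UNIV. (S $ a $ e * S $ b $ e / S $ vac $ e) * (cnj (S $ c $ e) * h c))"
      unfolding fusion_coeff_def sum_distrib_right by (intro sum.cong refl) simp
    also have "\<dots> = (\<Sum>e\<in>UNIV. \<Sum>c\<in>UNIV. (S $ a $ e * S $ b $ e / S $ vac $ e) * (cnj (S $ c $ e) * h c))"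
      by (rule sum.swap)
    finally show ?thesis by (simp only: sum_distrib_left)
  qed
  have verlinde: "S $ a $ d * S $ b $ d = S $ vac $ d * (\<Sum>c\<in>UNIV. fusion_coeff vac S a b c * S $ c $ d)"
    for a b d
    using vac_nz[of d]
    by (simp add: fusion_sum cols if_distrib[of "\<lambda>x. _ * x"] cong: if_cong)

  define t where "t a d = \<sigma> (S $ a $ d)" for a d
  have t_nz: "t vac d \<noteq> 0" for d
    using aut_simps(4)[of "S $ vac $ d" "of_nat 0"] K_of_nat[of 0] vac_nz[of d] \<sigma>_of_nat[of 0]
    by (auto simp: t_def)
  have t_verlinde: "t a d * t b d = t vac d * (\<Sum>c\<in>UNIV. fusion_coeff vac S a b c * t c d)" for a b d
  proof -
    have "\<exists>n. fusion_coeff vac S a b c = of_nat n" for c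
      using fusion_nat[of a b c] by (rule Nats_cases) blast
    then obtain N where N: "\<And>c. fusion_coeff vac S a b c = of_nat (N c)"
      by metis
    show ?thesis
      using arg_cong[OF verlinde[of a d b], of \<sigma>]
      by (simp add: N t_def aut_simps(3) \<sigma>_sum \<sigma>_of_nat)
  qed
  \<comment> \<open>Every character of the fusion ring is one of the \<open>a \<mapsto> S $ a $ f / S $ vac $ f\<close>.\<close>
  have "\<exists>f. \<forall>a. t a d * S $ vac $ f = t vac d * S $ a $ f" for d
  proof -
    define w where "w e = (\<Sum>c\<in>UNIV. cnj (S $ c $ e) * t c d)" for e
    \<comment> \<open>The numbers \<open>w f\<close> are the coordinates of the column \<open>t _ d\<close> in the orthonormal basis of columns of \<open>S\<close>.\<close>
    have "\<exists>f. w f \<noteq> 0"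
    proof (rule ccontr)
      assume "\<not> ?thesis"
      then have "0 = (\<Sum>e\<in>UNIV. S $ vac $ e * w e)" by simp
      also have "\<dots> = (\<Sum>e\<in>UNIV. \<Sum>c\<in>UNIV. S $ vac $ e * cnj (S $ c $ e) * t c d)"
        by (simp add: w_def sum_distrib_left mult.assoc)
      also have "\<dots> = (\<Sum>c\<in>UNIV. \<Sum>e\<in>UNIV. S $ vac $ e * cnj (S $ c $ e) * t c d)"
        by (rule sum.swap)
      also have "\<dots> = (\<Sum>c\<in>UNIV. (if vac = c then 1 else 0) * t c d)"
        by (simp add: rows flip: sum_distrib_right)
      also have "\<dots> = t vac d"
        by (simp add: if_distrib[of "\<lambda>x. x * _"] cong: if_cong)
      finally show False using t_nz by simp
    qed
    then obtain f where f: "w f \<noteq> 0" by blast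
    have "t a d * S $ vac $ f = t vac d * S $ a $ f" for a
    proof -
      \<comment> \<open>Expanded in the columns of \<open>S\<close>, to compare the \<open>f\<close>-th coordinates of both sides.\<close>
      have prod: "t a d * t b d = (\<Sum>e\<in>UNIV. (t vac d * (S $ a $ e / S $ vac $ e) * w e) * S $ b $ e)" for b
        unfolding t_verlinde[of a d b] fusion_sum w_def[symmetric] sum_distrib_left
        by (intro sum.cong refl) simp
      have "t a d * w f = (\<Sum>b\<in>UNIV. cnj (S $ b $ f) * (t a d * t b d))"
        by (simp add: w_def sum_distrib_left mult_ac)
      also have "\<dots> = (\<Sum>b\<in>UNIV. cnj (S $ b $ f) *
          (\<Sum>e\<in>UNIV. (t vac d * (S $ a $ e / S $ vac $ e) * w e) * S $ b $ e))"
        by (simp only: prod)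
      also have "\<dots> = t vac d * (S $ a $ f / S $ vac $ f) * w f"
        by (rule expand)
      finally show ?thesis using f vac_nz[of f] by (simp add: field_simps)
    qed
    then show ?thesis by blast
  qed
  then obtain \<pi> where \<pi>: "\<And>d a. t a d * S $ vac $ \<pi> d = t vac d * S $ a $ \<pi> d"
    by metis
  have "inj \<pi>"
  proof (rule injI, rule ccontr)
    fix d e assume eq: "\<pi> d = \<pi> e" and ne: "d \<noteq> e"
    have "S $ a $ d * S $ vac $ e = S $ a $ e * S $ vac $ d" for a
    proof -
      have "(t a d * t vac e) * S $ vac $ \<pi> e = (t a d * S $ vac $ \<pi> d) * t vac e"
        by (simp add: eq mult_ac)
      also have "\<dots> = (t vac e * S $ a $ \<pi> e) * t vac d"
        unfolding \<pi> by (simp add: eq mult_ac)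
      also have "\<dots> = (t a e * t vac d) * S $ vac $ \<pi> e"
        unfolding \<pi>[symmetric] by (simp add: mult_ac)
      finally have "t a d * t vac e = t a e * t vac d"
        using vac_nz by simp
      then have "\<sigma> (S $ a $ d * S $ vac $ e) = \<sigma> (S $ a $ e * S $ vac $ d)"
        by (simp add: t_def aut_simps(3))
      then show ?thesis
        by (rule aut_simps(4)[rotated 2]) simp_all
    qed
    then have "(\<Sum>a\<in>UNIV. cnj (S $ a $ d) * (S $ a $ d * S $ vac $ e))
        = (\<Sum>a\<in>UNIV. cnj (S $ a $ d) * (S $ a $ e * S $ vac $ d))"
      by simp
    then have "S $ vac $ e = 0"
      using ne by (simp add: cols flip: mult.assoc sum_distrib_right)
    then show False using vac_nz by blast
  qed
  then have "bij \<pi>"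
    by (simp add: finite_UNIV_inj_surj bij_def)
  \<comment> \<open>Apply \<open>\<sigma>\<close> to the norm of the \<open>d\<close>-th column of \<open>S\<close>, written without complex conjugation.\<close>
  have square: "(S $ vac $ \<pi> d)\<^sup>2 = (t vac d)\<^sup>2" for d
  proof -
    have norm: "(\<Sum>a\<in>UNIV. S $ C a $ d * S $ a $ d) = 1" for d
      using cols[of d d] by (simp add: cnj_S)
    have "(\<Sum>a\<in>UNIV. t (C a) d * t a d) = 1"
      using arg_cong[OF norm[of d], of \<sigma>] \<sigma>_of_nat[of 1] by (simp add: \<sigma>_sum t_def aut_simps(3))
    then have "(S $ vac $ \<pi> d)\<^sup>2 = (S $ vac $ \<pi> d)\<^sup>2 * (\<Sum>a\<in>UNIV. t (C a) d * t a d)"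
      by simp
    also have "\<dots> = (\<Sum>a\<in>UNIV. (t (C a) d * S $ vac $ \<pi> d) * (t a d * S $ vac $ \<pi> d))"
      unfolding sum_distrib_left by (intro sum.cong refl) (simp add: power2_eq_square mult_ac)
    also have "\<dots> = (t vac d)\<^sup>2 * (\<Sum>a\<in>UNIV. S $ C a $ \<pi> d * S $ a $ \<pi> d)"
      unfolding \<pi> sum_distrib_left by (intro sum.cong refl) (simp add: power2_eq_square mult_ac)
    finally show ?thesis by (simp add: norm)
  qed
  define \<epsilon> where "\<epsilon> d = (if t vac d = S $ vac $ \<pi> d then 1 else - 1 :: complex)" for d
  have t_vac: "t vac d = \<epsilon> d * S $ vac $ \<pi> d" for d
    using square[of d] by (auto simp: \<epsilon>_def power2_eq_iff)
  have t_eq: "t a d = \<epsilon> d * S $ a $ \<pi> d" for a d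
    using \<pi>[of a d] vac_nz[of "\<pi> d"] by (simp add: t_vac)
  have "is_galois_action \<sigma> S \<epsilon> \<pi>"
    unfolding is_galois_action_def
  proof (intro conjI allI)
    show "\<epsilon> a \<in> {1, - 1}" for a by (simp add: \<epsilon>_def)
    show "bij \<pi>" by fact
    show "\<sigma> (S $ a $ b) = \<epsilon> b * S $ a $ \<pi> b" for a b
      using t_eq by (simp add: t_def)
    then show "\<sigma> (S $ a $ b) = \<epsilon> a * S $ \<pi> a $ b" for a b
      by (metis sym)
  qed
  then show ?thesis by blast
qed

text \<open>
  Any signed permutation matrix \<open>G\<close> of the Galois action satisfies \<open>G S = \<sigma>(S)\<close>; cancelling \<open>S\<close>
  shows that there is only one, so the definite description is the matrix of any given action.
\<close>

lemma galois_matrix_mult: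
  fixes S :: "complex ^ 'n::finite ^ 'n"
  assumes inv: "S ** R = mat 1"
    and ex: "\<exists>\<epsilon> \<pi>. is_galois_action (cyclotomic_aut M l) S \<epsilon> \<pi>"
  shows "galois_matrix M S l ** S = (\<chi> a b. cyclotomic_aut M l (S $ a $ b))"
proof -
  let ?G = "\<lambda>\<epsilon> \<pi>. \<chi> a b. if b = \<pi> a then \<epsilon> a else (0 :: complex)"
  have GS: "?G \<epsilon> \<pi> ** S = (\<chi> a b. cyclotomic_aut M l (S $ a $ b))"
    if "is_galois_action (cyclotomic_aut M l) S \<epsilon> \<pi>" for \<epsilon> \<pi>
    using that
    by (simp add: vec_eq_iff matrix_matrix_mult_def is_galois_action_def
        if_distrib[of "\<lambda>x. x * _"] cong: if_cong)
  obtain \<epsilon> \<pi> where act: "is_galois_action (cyclotomic_aut M l) S \<epsilon> \<pi>"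
    using ex by blast
  have "galois_matrix M S l = ?G \<epsilon> \<pi>"
    unfolding galois_matrix_def
  proof (rule the_equality)
    show "\<exists>\<epsilon>' \<pi>'. is_galois_action (cyclotomic_aut M l) S \<epsilon>' \<pi>' \<and> ?G \<epsilon> \<pi> = ?G \<epsilon>' \<pi>'"
      using act by blast
    fix G assume "\<exists>\<epsilon> \<pi>. is_galois_action (cyclotomic_aut M l) S \<epsilon> \<pi> \<and> G = ?G \<epsilon> \<pi>"
    then have "G ** S = ?G \<epsilon> \<pi> ** S"
      using GS act by auto
    then have "G ** (S ** R) = ?G \<epsilon> \<pi> ** (S ** R)"
      by (simp add: matrix_mul_assoc)
    then show "G = ?G \<epsilon> \<pi>"
      by (simp add: inv)
  qed
  then show ?thesis using GS[OF act] by simp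
qed

section \<open>The commutant as a rational linear system\<close>

lemma matrix_commute_mult:
  fixes X A B :: "'a::semiring_1 ^ 'n::finite ^ 'n"
  assumes "X ** A = A ** X" "X ** B = B ** X"
  shows "X ** (A ** B) = (A ** B) ** X"
proof -
  have "X ** (A ** B) = A ** (X ** B)"
    by (simp only: matrix_mul_assoc assms(1))
  then show ?thesis
    by (simp only: matrix_mul_assoc assms(2))
qed

lemma matrix_commute_pow:
  fixes X A :: "'a::semiring_1 ^ 'n::finite ^ 'n"
  assumes "X ** A = A ** X"
  shows "X ** mat_pow A k = mat_pow A k ** X"
proof (induction k)
  case (Suc k)
  show ?case
    unfolding mat_pow.simps by (rule matrix_commute_mult[OF assms Suc])
qed simp

lemma commute_diagonal_iff:
  fixes X T :: "complex ^ 'n::finite ^ 'n"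
  assumes diag: "\<And>a b. a \<noteq> b \<Longrightarrow> T $ a $ b = 0"
  shows "X ** T = T ** X \<longleftrightarrow> (\<forall>a b. T $ a $ a \<noteq> T $ b $ b \<longrightarrow> X $ a $ b = 0)"
proof -
  have T: "T $ a $ b = (if a = b then T $ a $ a else 0)" for a b
    using diag by simp
  have "(X ** T) $ a $ b = X $ a $ b * T $ b $ b" for a b
    unfolding matrix_matrix_mult_def by (subst T) (simp add: if_distrib[of "\<lambda>x. _ * x"] cong: if_cong)
  moreover have "(T ** X) $ a $ b = T $ a $ a * X $ a $ b" for a b
    unfolding matrix_matrix_mult_def by (subst T) (simp add: if_distrib[of "\<lambda>x. x * _"] cong: if_cong)
  ultimately show ?thesis
    by (simp add: vec_eq_iff mult.commute) metis
qed

text \<open>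
  The matrix on both sides is \<open>\<sigma>(S)\<close> for the automorphism \<open>\<sigma>\<close> that moves \<open>\<xi> M\<close> to \<open>r\<close>. It equals
  \<open>G S\<close>, a word in \<open>S\<close> and \<open>T\<close>. The exponents \<open>l\<close> and \<open>m\<close> in this word are chosen
  nonnegative, so that only products of \<open>S\<close> and \<open>T\<close> themselves occur.
\<close>

lemma commute_conjugate:
  fixes S T :: "complex ^ 'n::finite ^ 'n"
  assumes modular: "modular_data vac S T" and M: "M > 0"
    and entries: "\<And>a b. S $ a $ b \<in> cyclotomic_field M"
    and galois_G: "\<And>l m :: int. coprime l (int M) \<Longrightarrow> [l * m = 1] (mod int (mat_order T)) \<Longrightarrow>
            galois_matrix M S l = S ** mat_zpow T m ** S ** mat_zpow T l ** S ** mat_zpow T m"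
    and f: "is_minimal_poly (\<xi> M) f" and r: "rat_eval f r = 0"
    and P: "\<And>a b. rat_eval (P a b) (\<xi> M) = S $ a $ b"
    and X: "X ** S = S ** X" "X ** T = T ** X"
  shows "X ** (\<chi> a b. rat_eval (P a b) r) = (\<chi> a b. rat_eval (P a b) r) ** X"
proof -
  obtain n where "n > 0 \<and> mat_pow T n = mat 1"
    using modular by (auto simp: modular_data_def finite_order_def)
  then have ord: "mat_order T > 0"
    unfolding mat_order_def by (rule LeastI2) simp
  obtain l where l: "coprime l M" "coprime l (mat_order T)" "r = \<xi> M ^ l"
    by (rule conjugate_is_coprime_power[OF M f r ord])
  obtain m where m: "[l * m = Suc 0] (mod mat_order T)"
    using cong_solve_coprime_nat[OF l(2)] by auto
  have aut: "is_cyclotomic_aut M (int l) (cyclotomic_aut M (int l))"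
    using cyclotomic_aut_conjugate[OF M f _ l(1)] r l(3) by simp
  have "galois_matrix M S (int l) ** S = (\<chi> a b. cyclotomic_aut M (int l) (S $ a $ b))"
  proof (rule galois_matrix_mult)
    show "S ** adjoint_mat S = mat 1"
      using modular by (simp add: modular_data_def unitary_mat_def)
    show "\<exists>\<epsilon> \<pi>. is_galois_action (cyclotomic_aut M (int l)) S \<epsilon> \<pi>"
      by (rule galois_action_exists[OF modular entries aut])
  qed
  also have "\<dots> = (\<chi> a b. rat_eval (P a b) r)"
    using is_cyclotomic_aut_rat_eval[OF aut] P l(3) by (simp add: vec_eq_iff flip: P)
  finally have conj: "(\<chi> a b. rat_eval (P a b) r) = galois_matrix M S (int l) ** S" ..
  have "[int l * int m = 1] (mod int (mat_order T))"
    using m by (metis cong_int_iff of_nat_1 of_nat_mult One_nat_def)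
  then have "galois_matrix M S (int l)
      = S ** mat_pow T m ** S ** mat_pow T l ** S ** mat_pow T m"
    using galois_G[of "int l" "int m"] l(1) by (simp add: mat_zpow_def)
  then show ?thesis
    unfolding conj by (simp only:) (intro matrix_commute_mult matrix_commute_pow X)
qed

theorem proposition5:
  fixes vac :: "'n::finite"
    and S T :: "complex ^ 'n ^ 'n"
    and M N :: nat
  assumes modular: "modular_data vac S T"
    and M_pos: "0 < M"
    and entries: "\<And>a b. S $ a $ b \<in> cyclotomic_field M \<and> T $ a $ b \<in> cyclotomic_field M"
    and N_pos: "0 < N"
    and congruence: "congruence_property N S T"
    and galois_T: "\<And>l :: int. coprime l (int M) \<Longrightarrow>
          galois_matrix M S l ** T = mat_zpow T (l ^ 2) ** galois_matrix M S l"
    and galois_G: "\<And>l m :: int. coprime l (int M) \<Longrightarrow> [l * m = 1] (mod int (mat_order T)) \<Longrightarrow>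
          galois_matrix M S l =
            S ** mat_zpow T m ** S ** mat_zpow T l ** S ** mat_zpow T m \<and>
          galois_matrix M S l =
            mat_zpow T l ** S ** mat_zpow T m ** S ** mat_zpow T l ** S"
  shows "\<exists>B. B \<subseteq> commutant S T \<and> cmat.independent B \<and> cmat.span B = commutant S T \<and>
             (\<forall>X\<in>B. \<forall>i j. X $ i $ j \<in> \<int>)"
proof -
  have "rat_eval ([:0, 1:] ^ M - 1) (\<xi> M) = 0"
    using xi_power_eq_1_iff[OF M_pos, of M] by simp
  moreover have "[:0, 1:] ^ M - 1 \<noteq> (0 :: rat poly)"
  proof
    assume "[:0, 1:] ^ M - 1 = (0 :: rat poly)"
    then have "rat_eval ([:0, 1:] ^ M - 1) 0 = 0" by simp
    then show False using M_pos by (simp add: power_0_left)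
  qed
  ultimately obtain f where f: "is_minimal_poly (\<xi> M) f"
    using is_minimal_poly_exists by blast
  have f0: "f \<noteq> 0" and f_root: "rat_eval f (\<xi> M) = 0"
    using f by (auto simp: is_minimal_poly_def)
  have deg_f: "degree f > 0"
  proof (rule ccontr)
    assume "\<not> degree f > 0"
    then obtain c where "f = [:c:]" by (auto elim: degree_eq_zeroE)
    then show False using f0 f_root by simp
  qed

  have "\<exists>p. rat_eval p (\<xi> M) = S $ a $ b \<and> degree p < degree f" for a b
  proof -
    obtain p where "rat_eval p (\<xi> M) = S $ a $ b"
      using entries[of a b] by (metis cyclotomic_field_iff)
    then have "rat_eval (p mod f) (\<xi> M) = S $ a $ b"
      using f_root by (simp flip: minus_div_mult_eq_mod)
    moreover have "degree (p mod f) < degree f"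
      using degree_mod_less[OF f0, of p] deg_f by auto
    ultimately show ?thesis by blast
  qed
  then obtain P where P: "\<And>a b. rat_eval (P a b) (\<xi> M) = S $ a $ b" "\<And>a b. degree (P a b) < degree f"
    by metis

  \<comment> \<open>The entries of \<open>X S - S X\<close>, with the powers of \<open>\<xi> M\<close> replaced by those of an indeterminate.\<close>
  define Q where "Q X a b = (\<Sum>c\<in>UNIV. smult (X $ a $ c) (map_poly of_rat (P c b))
      - smult (X $ c $ b) (map_poly of_rat (P a c)))" for X :: "complex ^ 'n ^ 'n" and a b
  have poly_Q: "poly (Q X a b) z = (X ** (\<chi> a b. rat_eval (P a b) z)) $ a $ b
      - ((\<chi> a b. rat_eval (P a b) z) ** X) $ a $ b" for X a b z
    by (simp add: Q_def poly_sum matrix_matrix_mult_def rat_eval_def sum_subtractf mult.commute)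
  have S_eq: "(\<chi> a b. rat_eval (P a b) (\<xi> M)) = S"
    by (simp add: vec_eq_iff P)
  \<comment> \<open>Degree below \<open>degree f\<close>, but a zero at each of the \<open>degree f\<close> roots of \<open>f\<close>.\<close>
  have Q0: "Q X a b = 0" if X: "X ** S = S ** X" "X ** T = T ** X" for X a b
  proof (rule ccontr)
    assume ne: "Q X a b \<noteq> 0"
    have "degree f = card {r. rat_eval f r = 0}"
      using card_conjugates(1)[OF M_pos f] by simp
    also have "\<dots> \<le> card {r. poly (Q X a b) r = 0}"
    proof (intro card_mono subsetI CollectI)
      fix r assume "r \<in> {r. rat_eval f r = 0}"
      then show "poly (Q X a b) r = 0"
        unfolding poly_Q
        using commute_conjugate[OF modular M_pos _ _ f _ P(1) X, of r] entries galois_G by simp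
    qed (rule poly_roots_finite[OF ne])
    also have "\<dots> \<le> degree (Q X a b)"
      by (rule card_poly_roots_bound[OF ne])
    also have "\<dots> < degree f"
      unfolding Q_def
    proof (rule degree_sum_less)
      have "degree (smult x (map_poly of_rat (P c d))) < degree f" for x :: complex and c d
        by (rule le_less_trans[OF degree_smult_le le_less_trans[OF map_poly_degree_leq P(2)]])
      then show "degree (smult (X $ a $ c) (map_poly of_rat (P c b))
          - smult (X $ c $ b) (map_poly of_rat (P a c))) < degree f" for c
        by (intro degree_diff_less)
    qed (rule deg_f)
    finally show False by simp
  qed
  have S_iff: "X ** S = S ** X" if "\<And>a b. Q X a b = 0" for X
    using poly_Q[of X _ _ "\<xi> M"] that unfolding S_eq by (simp add: vec_eq_iff)

  \<comment> \<open>The rational coefficients of the \<open>k\<close>-th coefficient of \<open>Q X a b\<close>, as a linear form in \<open>X\<close>.\<close>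
  define qS where "qS a b k i j = (if i = a then coeff (P j b) k else 0) - (if j = b then coeff (P a i) k else 0)"
    for a b i j :: 'n and k
  have qS: "(\<Sum>i\<in>UNIV. \<Sum>j\<in>UNIV. of_rat (qS a b k i j) * X $ i $ j) = coeff (Q X a b) k" for X a b k
  proof -
    have "(\<Sum>i\<in>UNIV. \<Sum>j\<in>UNIV. of_rat (qS a b k i j) * X $ i $ j)
        = (\<Sum>i\<in>UNIV. if i = a then (\<Sum>j\<in>UNIV. of_rat (coeff (P j b) k) * X $ i $ j) else 0)
          - (\<Sum>i\<in>UNIV. \<Sum>j\<in>UNIV. if j = b then of_rat (coeff (P a i) k) * X $ i $ j else 0)"
      unfolding sum_subtractf[symmetric]
      by (intro sum.cong refl)
        (auto simp: qS_def of_rat_diff left_diff_distrib sum_subtractf if_distrib[of "\<lambda>x. x * _"]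
          if_distrib[of of_rat] cong: if_cong)
    also have "\<dots> = coeff (Q X a b) k"
      by (simp add: Q_def coeff_sum coeff_map_poly sum_subtractf mult.commute)
    finally show ?thesis .
  qed
  define qT where "qT a b i j = (if i = a then if j = b then 1 else 0 else 0 :: rat)" for a b i j :: 'n
  have qT: "(\<Sum>i\<in>UNIV. \<Sum>j\<in>UNIV. of_rat (qT a b i j) * X $ i $ j) = X $ a $ b" for X :: "complex ^ 'n ^ 'n" and a b
  proof -
    have "(\<Sum>i\<in>UNIV. \<Sum>j\<in>UNIV. of_rat (qT a b i j) * X $ i $ j)
        = (\<Sum>i\<in>UNIV. if i = a then \<Sum>j\<in>UNIV. if j = b then X $ i $ j else 0 else 0)"
      by (intro sum.cong refl) (auto simp: qT_def if_distrib[of of_rat] if_distrib[of "\<lambda>x. x * _"] cong: if_cong)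
    then show ?thesis by simp
  qed
  have T_iff: "X ** T = T ** X \<longleftrightarrow> (\<forall>a b. T $ a $ a \<noteq> T $ b $ b \<longrightarrow> X $ a $ b = 0)" for X
    using modular by (intro commute_diagonal_iff) (simp add: modular_data_def)
  let ?Q = "{qS a b k | a b k. True} \<union> {qT a b | a b. T $ a $ a \<noteq> T $ b $ b}"
  have "commutant S T = {X. \<forall>q\<in>?Q. (\<Sum>i\<in>UNIV. \<Sum>j\<in>UNIV. of_rat (q i j) * X $ i $ j) = 0}"
  proof (intro equalityI subsetI CollectI ballI)
    fix X q assume "X \<in> commutant S T" "q \<in> ?Q"
    then show "(\<Sum>i\<in>UNIV. \<Sum>j\<in>UNIV. of_rat (q i j) * X $ i $ j) = 0"
      using Q0[of X] T_iff[of X] by (auto simp: commutant_def qS qT)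
  next
    fix X :: "complex ^ 'n ^ 'n"
    assume X: "X \<in> {X. \<forall>q\<in>?Q. (\<Sum>i\<in>UNIV. \<Sum>j\<in>UNIV. of_rat (q i j) * X $ i $ j) = 0}"
    have "Q X a b = 0" for a b
    proof (rule poly_eqI)
      fix k
      have "qS a b k \<in> ?Q" by blast
      then show "coeff (Q X a b) k = coeff 0 k"
        using X qS[of a b k X] by simp
    qed
    moreover have "X $ a $ b = 0" if "T $ a $ a \<noteq> T $ b $ b" for a b
    proof -
      have "qT a b \<in> ?Q" using that by blast
      then show ?thesis using X qT[of a b X] by simp
    qed
    ultimately show "X \<in> commutant S T"
      using S_iff T_iff by (simp add: commutant_def)
  qed
  then show ?thesis
    using integer_basis_of_rational_equations[of ?Q] by simp
qed

end
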